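(* Let $k,r$ be positive integers, $p_1,\dots,p_k\in\mathbb{N}_0$, $m_1,\dots,m_{k-1}\in\mathbb{N}_0$, $m_k\in\mathbb{N}$, $k_1,\dots,k_{r-1}\in\mathbb{N}_0$, $k_r\in\mathbb{N}$, and $|p|_j=p_1+\cdots+p_j$ ($|p|_0=0$). Then \begin{align*} \zeta\left(\mathbf{k}_r^v,(\mathbf{p}_k\Box\mathbf{m}_k)^v\right)&=\sum_{i=1}^k(-1)^{|p|_{i-1}}\sum_{j=1}^{p_i}(-1)^{j-1}\zeta\left(E'_i,\{1\}_{p_i-j}\right)\,\zeta\left((k_r+1,\dots,k_1+1)\circledast(0,F'_i,\{1\}_{j-1})^\star\right)\\ &\quad+(-1)^{|p|_k}\zeta\left((k_r+1,\dots,k_1+1)\circledast(0,F'_{k+1})^\star\right), \end{align*} where $\mathbf{k}_r^v=\big(2\Box\{1\}_{k_1-1}\Box2\Box\{1\}_{k_2-1}\Box\cdots\Box2\Box\{1\}_{k_{r-1}-1}\Box2,\{1\}_{k_r-1}\big)$, $(\mathbf p_k\Box\mathbf m_k)^v=\big(\{p_1+1\}\Box\{1\}_{m_1-1}\Box\{p_2+1\}\Box\cdots\Box\{p_{k-1}+1\}\Box\{1\}_{m_{k-1}-1}\Box\{p_k+1\},\{1\}_{m_k-1}\big)$, $E'_i=\{m_k+1\}\Box\{1\}_{p_k-1}\Box\{m_{k-1}+1\}\Box\cdots\Box\{m_{i+1}+1\}\Box\{1\}_{p_{i+1}-1}\Box\{m_i+1\}$ ($E'_k=(m_k+1)$), $F'_i=\{1\}_{p_1-1}\Box\{m_1+1\}\Box\{1\}_{p_2-1}\Box\cdots\Box\{1\}_{p_{i-1}-1}\Box\{m_{i-1}+1\}$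 ($F'_1=\emptyset$), with the conventions in the context.
   Context: Multiple zeta values $\zeta(s_1,\dots,s_r)=\sum_{n_1>\cdots>n_r\ge1}n_1^{-s_1}\cdots n_r^{-s_r}$ ($s_1\ge2$); harmonic sums $\zeta_n(s_1,\dots,s_r)=\sum_{n\ge n_1>\cdots>n_r\ge1}\prod n_j^{-s_j}$, $\zeta^\star_n(s_1,\dots,s_r)=\sum_{n\ge n_1\ge\cdots\ge n_r\ge1}\prod n_j^{-s_j}$, both $1$ for empty index. $\{1\}_d$: $d$ entries $1$. Box convention: in $u\,\Box\,\{1\}_{q-1}\,\Box\,v$ write $u,\{1\}_{q-1},v$ if $q\ge1$; if $q=0$ replace the neighbours $u,v$ by the single entry $u+v-1$ (repeatedly for consecutive zeros). Kaneko–Yamamoto value: for a sequence $L$, $\zeta\left((k_r+1,\dots,k_1+1)\circledast(0,L)^\star\right)=\sum_{n\ge1}\frac{\zeta_{n-1}(k_{r-1}+1,\dots,k_1+1)\,\zeta^\star_n(L)}{n^{k_r+1}}$. Leading convention for $L=(F'_i,\{1\}_{j-1})$: evaluate $1\,\Box\,\{1\}_{p_1-1}\,\Box\,\{m_1+1\}\Box\cdots\Box\{m_{i-1}+1\}$ (just $(1)$ if $i=1$) by the Box convention as $(x_0,x_1,\dots,x_q)$ and interpret $\zeta^\star_n(F'_i,\{1\}_{j-1})$ as $n^{1-x_0}\zeta^\star_n(x_1,\dots,x_q,\{1\}_{j-1})$. *)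

theory Defs
  imports "HOL-Analysis.Analysis"
begin

definition mzv :: "nat list \<Rightarrow> real" where
  "mzv s = (\<Sum>\<^sub>\<infinity>ns\<in>{ns. length ns = length s \<and> sorted_wrt (>) ns \<and> (\<forall>a\<in>set ns. 1 \<le> a)}.
     \<Prod>i<length s. 1 / real (ns ! i) ^ (s ! i))"

definition zeta_sum :: "nat \<Rightarrow> nat list \<Rightarrow> real" where
  "zeta_sum n s = (\<Sum>ns\<in>{ns. length ns = length s \<and> sorted_wrt (>) ns \<and> set ns \<subseteq> {1..n}}.
     \<Prod>i<length s. 1 / real (ns ! i) ^ (s ! i))"

definition zeta_star_sum :: "nat \<Rightarrow> nat list \<Rightarrow> real" where
  "zeta_star_sum n s = (\<Sum>ns\<in>{ns. length ns = length s \<and> sorted_wrt (\<ge>) ns \<and> set ns \<subseteq> {1..n}}.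
     \<Prod>i<length s. 1 / real (ns ! i) ^ (s ! i))"

text \<open>\<open>box u\<^sub>0 [(q\<^sub>1, u\<^sub>1), \<dots>, (q\<^sub>t, u\<^sub>t)]\<close> evaluates
  \<open>u\<^sub>0 \<box> {1}\<^bsub>q\<^sub>1-1\<^esub> \<box> u\<^sub>1 \<box> \<dots> \<box> {1}\<^bsub>q\<^sub>t-1\<^esub> \<box> u\<^sub>t\<close>.
  All \<open>u\<^sub>i\<close> are at least 1 in every use, so the subtraction does not truncate.\<close>

fun box :: "nat \<Rightarrow> (nat \<times> nat) list \<Rightarrow> nat list" where
  "box u [] = [u]"
| "box u ((q, v) # xs) =
     (if q = 0 then box (u + v - 1) xs else u # replicate (q - 1) 1 @ box v xs)"

text \<open>The harmonic star sum of a sequence \<open>L\<close> whose box evaluation may need a left neighbour: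
  the argument is the value \<open>(x\<^sub>0, x\<^sub>1, \<dots>)\<close> of \<open>1 \<box> L\<close>, and it stands for
  \<open>n\<^bsup>1-x\<^sub>0\<^esup> \<zeta>\<^sup>\<star>\<^sub>n(x\<^sub>1, \<dots>)\<close>.  An ordinary sequence \<open>L\<close> is passed as \<open>1 # L\<close>.\<close>

definition zeta_star_lead :: "nat \<Rightarrow> nat list \<Rightarrow> real" where
  "zeta_star_lead n xs = real n powi (1 - int (hd xs)) * zeta_star_sum n (tl xs)"

text \<open>\<open>ky_value ks xs\<close> is the Kaneko--Yamamoto value \<open>\<zeta>(ks \<circledast> (0, L)\<^sup>\<star>)\<close>, with \<open>L\<close> given by
  \<open>xs\<close>, the value of \<open>1 \<box> L\<close>, as in \<^const>\<open>zeta_star_lead\<close>.\<close>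

definition ky_value :: "nat list \<Rightarrow> nat list \<Rightarrow> real" where
  "ky_value ks xs =
     (\<Sum>\<^sub>\<infinity>n\<in>{1..}. zeta_sum (n - 1) (tl ks) * zeta_star_lead n xs / real n ^ hd ks)"

lemma ky_value_ordinary:
  "ky_value ks (1 # L) =
     (\<Sum>\<^sub>\<infinity>n\<in>{1..}. zeta_sum (n - 1) (tl ks) * zeta_star_sum n L / real n ^ hd ks)"
  by (simp add: ky_value_def zeta_star_lead_def)

definition kv_index :: "(nat \<Rightarrow> nat) \<Rightarrow> nat \<Rightarrow> nat list" where
  "kv_index \<kappa> r = box 2 (map (\<lambda>j. (\<kappa> j, 2)) [1..<r]) @ replicate (\<kappa> r - 1) 1"

definition pmv_index :: "(nat \<Rightarrow> nat) \<Rightarrow> (nat \<Rightarrow> nat) \<Rightarrow> nat \<Rightarrow> nat list" where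
  "pmv_index p m k =
     box (p 1 + 1) (map (\<lambda>j. (m j, p (j + 1) + 1)) [1..<k]) @ replicate (m k - 1) 1"

definition E_index :: "(nat \<Rightarrow> nat) \<Rightarrow> (nat \<Rightarrow> nat) \<Rightarrow> nat \<Rightarrow> nat \<Rightarrow> nat list" where
  "E_index p m k i = box (m k + 1) (map (\<lambda>j. (p (j + 1), m j + 1)) (rev [i..<k]))"

text \<open>\<open>1 \<box> F'\<^sub>i\<close>, i.e. \<open>F'\<^sub>i\<close> together with the left neighbour required by
  \<^const>\<open>zeta_star_lead\<close>.\<close>

definition lead_F_index :: "(nat \<Rightarrow> nat) \<Rightarrow> (nat \<Rightarrow> nat) \<Rightarrow> nat \<Rightarrow> nat list" where
  "lead_F_index p m i = box 1 (map (\<lambda>j. (p j, m j + 1)) [1..<i])"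

end

theory Submission
  imports Defs
begin

text \<open>
  In the letters \<open>X\<close>, \<open>Y\<close> the index on the left is the word
  \<open>X Y\<^bsup>k\<^sub>1\<^esup> \<cdots> X Y\<^bsup>k\<^sub>r\<^esup> X\<^bsup>p\<^sub>1\<^esup> Y\<^bsup>m\<^sub>1\<^esup> \<cdots> X\<^bsup>p\<^sub>k\<^esup> Y\<^bsup>m\<^sub>k\<^esup>\<close>. By duality its zeta value is that of
  \<open>X\<^bsup>m\<^sub>k\<^esup> Y\<^bsup>p\<^sub>k\<^esup> \<cdots> X\<^bsup>m\<^sub>1\<^esup> Y\<^bsup>p\<^sub>1\<^esup> X\<^bsup>k\<^sub>r\<^esup> Y \<cdots> X\<^bsup>k\<^sub>1\<^esup> Y\<close>. Duality is proved with the connected sums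
  of Seki and Yamamoto: inserting the factor \<open>m! n! / (m + n)!\<close> between two multiple sums, a
  telescoping series moves one letter at a time from one sum to the other.

  Let \<open>n\<close> be the summation variable of the entry \<open>k\<^sub>r + 1\<close>. The variables to its left contribute a
  tail sum over values exceeding \<open>n\<close>. Writing each \<open>\<Sum>\<^bsub>b>n\<^esub>\<close> as \<open>\<Sum>\<^bsub>b\<ge>1\<^esub> - \<Sum>\<^bsub>b\<le>n\<^esub>\<close>, starting with the
  innermost one, splits off a zeta value of a prefix (the factors \<open>E'\<^sub>i, {1}\<close>) at every letter \<open>Y\<close> and
  leaves a star sum up to \<open>n\<close> with opposite sign (the factors \<open>F'\<^sub>i, {1}\<close>). Summation over \<open>n\<close> turns
  these into Kaneko--Yamamoto values.
\<close>

section \<open>Indices as words\<close>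

datatype letter = X | Y

fun swap_letter :: "letter \<Rightarrow> letter" where
  "swap_letter X = Y"
| "swap_letter Y = X"

definition dual_word :: "letter list \<Rightarrow> letter list" where
  "dual_word w = rev (map swap_letter w)"

text \<open>The entry \<open>a\<close> of an index becomes \<open>X\<^bsup>a-1\<^esup>Y\<close>, as in the iterated integral of a multiple
  zeta value. Box composition then becomes plain concatenation of powers of \<open>X\<close> and \<open>Y\<close>, also in
  the degenerate case \<open>q = 0\<close>.\<close>

definition index_word :: "nat list \<Rightarrow> letter list" where
  "index_word s = concat (map (\<lambda>a. replicate (a - 1) X @ [Y]) s)"

lemma index_word_simps [simp]:
  "index_word [] = []"
  "index_word (a # s) = replicate (a - 1) X @ Y # index_word s"
  "index_word (s @ t) = index_word s @ index_word t"
  "index_word (replicate c (Suc 0)) = replicate c Y"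
  by (induction c) (simp_all add: index_word_def)

lemma index_word_box:
  assumes "1 \<le> u" and "\<forall>(q, v)\<in>set xs. 1 \<le> v"
  shows "index_word (box u xs) =
    replicate (u - 1) X @ concat (map (\<lambda>(q, v). replicate q Y @ replicate (v - 1) X) xs) @ [Y]"
  using assms
proof (induction u xs rule: box.induct)
  case (2 u q v xs)
  have pos: "1 \<le> u" "1 \<le> v" "\<forall>(q, v)\<in>set xs. 1 \<le> v"
    using "2.prems" by auto
  show ?case
  proof (cases q)
    case 0
    \<comment> \<open>Merging two entries adds their numbers of letters \<open>X\<close>; positivity
      makes the truncated subtraction exact.\<close>
    have eq: "u + v - 1 - 1 = (u - 1) + (v - 1)" and le: "1 \<le> u + v - 1"
      using pos by auto
    show ?thesis
      using "2.IH"(1)[OF _ le pos(3)] unfolding eq by (simp add: 0 replicate_add)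
  next
    case (Suc q')
    then show ?thesis
      using "2.IH"(2)[OF _ pos(2,3)] by simp
  qed
qed simp

lemma box_pos:
  assumes "1 \<le> u" and "\<forall>(q, v)\<in>set xs. 1 \<le> v"
  shows "\<forall>a\<in>set (box u xs). 1 \<le> a"
  using assms by (induction u xs rule: box.induct) auto

lemma box_not_Nil [simp]: "box u xs \<noteq> []"
  by (induction u xs rule: box.induct) auto

section \<open>Recursions for finite harmonic sums on the largest variable\<close>

lemma sum_decreasing_lists_Cons:
  fixes f :: "nat \<Rightarrow> nat \<Rightarrow> real"
  assumes "finite B" and "\<And>b. finite (S b)"
  shows "(\<Sum>ns\<in>(\<lambda>(b, ns). b # ns) ` Sigma B S. \<Prod>i<Suc l. f i (ns ! i)) =
    (\<Sum>b\<in>B. f 0 b * (\<Sum>ns\<in>S b. \<Prod>i<l. f (Suc i) (ns ! i)))"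
proof -
  have "inj_on (\<lambda>(b, ns). b # ns) (Sigma B S)"
    by (auto simp: inj_on_def)
  then show ?thesis
    using assms
    by (simp add: sum.reindex sum.Sigma sum_distrib_left prod.lessThan_Suc_shift case_prod_unfold
        del: prod.lessThan_Suc)
qed

lemma finite_lists_within: "finite {ns. length ns = l \<and> P ns \<and> set ns \<subseteq> {1..n::nat}}"
  by (rule finite_subset[OF _ finite_lists_length_eq[of "{1..n}" l]]) auto

lemma zeta_sum_Nil [simp]: "zeta_sum n [] = 1"
proof -
  have "{ns. length ns = length ([]::nat list) \<and> sorted_wrt (>) ns \<and> set ns \<subseteq> {1..n}} = {[]}"
    by auto
  then show ?thesis by (simp add: zeta_sum_def)
qed

lemma zeta_star_sum_Nil [simp]: "zeta_star_sum n [] = 1"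
proof -
  have "{ns. length ns = length ([]::nat list) \<and> sorted_wrt (\<ge>) ns \<and> set ns \<subseteq> {1..n}} = {[]}"
    by auto
  then show ?thesis by (simp add: zeta_star_sum_def)
qed

lemma zeta_sum_Cons: "zeta_sum n (a # s) = (\<Sum>b=1..n. zeta_sum (b - 1) s / real b ^ a)"
proof -
  let ?S = "\<lambda>b. {ns. length ns = length s \<and> sorted_wrt (>) ns \<and> set ns \<subseteq> {1..b - 1}}"
  have *: "{ns. length ns = length (a # s) \<and> sorted_wrt (>) ns \<and> set ns \<subseteq> {1..n}} =
      (\<lambda>(b, ns). b # ns) ` Sigma {1..n} ?S"
    by (auto simp: length_Suc_conv image_iff subset_iff) force+
  show ?thesis
    unfolding zeta_sum_def * unfolding length_Cons
    by (subst sum_decreasing_lists_Cons[of "{1..n}" ?S "\<lambda>i x. 1 / real x ^ ((a # s) ! i)" "length s"])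
      (simp_all add: finite_lists_within del: One_nat_def)
qed

lemma zeta_star_sum_Cons: "zeta_star_sum n (a # s) = (\<Sum>b=1..n. zeta_star_sum b s / real b ^ a)"
proof -
  let ?S = "\<lambda>b. {ns. length ns = length s \<and> sorted_wrt (\<ge>) ns \<and> set ns \<subseteq> {1..b}}"
  have *: "{ns. length ns = length (a # s) \<and> sorted_wrt (\<ge>) ns \<and> set ns \<subseteq> {1..n}} =
      (\<lambda>(b, ns). b # ns) ` Sigma {1..n} ?S"
    by (auto simp: length_Suc_conv image_iff subset_iff)
  show ?thesis
    unfolding zeta_star_sum_def * unfolding length_Cons
    by (subst sum_decreasing_lists_Cons[of "{1..n}" ?S "\<lambda>i x. 1 / real x ^ ((a # s) ! i)" "length s"])
      (simp_all add: finite_lists_within del: One_nat_def)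
qed

text \<open>For \<open>w\<close> the word of a nonempty index, \<open>level w n\<close> is the part of the multiple zeta series whose
  largest summation variable is \<open>n\<close>. Division by zero makes \<open>level w 0\<close> vanish unless \<open>w\<close> is empty,
  and the empty word is concentrated at \<open>0\<close>.\<close>

fun level :: "letter list \<Rightarrow> nat \<Rightarrow> real" where
  "level [] n = (if n = 0 then 1 else 0)"
| "level (X # w) n = level w n / real n"
| "level (Y # w) n = (\<Sum>l<n. level w l) / real n"

lemma level_nonneg [simp]: "0 \<le> level w n"
  by (induction w n rule: level.induct) (auto intro!: sum_nonneg divide_nonneg_nonneg)

lemma level_0 [simp]: "w \<noteq> [] \<Longrightarrow> level w 0 = 0"
  by (cases "(w, 0::nat)" rule: level.cases) auto

lemma level_replicate_X: "level (replicate c X @ w) n = level w n / real n ^ c"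
  by (induction c) (auto simp: field_simps)

lemma level_index_word_Cons:
  assumes "1 \<le> a"
  shows "level (index_word (a # s)) n = (\<Sum>l<n. level (index_word s) l) / real n ^ a"
proof -
  obtain c where "a = Suc c"
    using assms by (cases a) auto
  then show ?thesis
    by (simp add: level_replicate_X)
qed

lemma sum_level_index_word:
  assumes "\<forall>a\<in>set s. 1 \<le> a" and "1 \<le> n"
  shows "(\<Sum>l<n. level (index_word s) l) = zeta_sum (n - 1) s"
  using assms
proof (induction s arbitrary: n)
  case Nil
  have "(\<Sum>l<n. level [] l) = (\<Sum>l\<in>{0::nat}. 1)"
    using Nil by (intro sum.mono_neutral_cong_right) auto
  then show ?case by simp
next
  case (Cons a s)
  have "(\<Sum>l<n. level (index_word (a # s)) l) = (\<Sum>l\<in>{1..n - 1}. level (index_word (a # s)) l)"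
    by (intro sum.mono_neutral_right) (auto simp: not_le Suc_le_eq)
  also have "\<dots> = (\<Sum>l\<in>{1..n - 1}. zeta_sum (l - 1) s / real l ^ a)"
  proof (intro sum.cong refl)
    fix l assume "l \<in> {1..n - 1}"
    then have "(\<Sum>i<l. level (index_word s) i) = zeta_sum (l - 1) s"
      using Cons by (intro Cons.IH) auto
    then show "level (index_word (a # s)) l = zeta_sum (l - 1) s / real l ^ a"
      using Cons.prems by (subst level_index_word_Cons) auto
  qed
  finally show ?case by (simp add: zeta_sum_Cons)
qed

lemma level_index_word:
  assumes "\<forall>a\<in>set (a # s). 1 \<le> a" and "1 \<le> n"
  shows "level (index_word (a # s)) n = zeta_sum (n - 1) s / real n ^ a"
  using assms sum_level_index_word[of s n] by (subst level_index_word_Cons) auto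

lemma sums_imp_has_sum_atLeast_1:
  fixes f g :: "nat \<Rightarrow> real"
  assumes "f sums S" and "\<And>n. 0 \<le> f n" and "f 0 = 0" and "\<And>n. 1 \<le> n \<Longrightarrow> g n = f n"
  shows "(g has_sum S) {1..}"
proof -
  have "(f has_sum S) UNIV"
    using assms by (intro sums_nonneg_imp_has_sum)
  then show ?thesis
    by (rule has_sum_cong_neutral[THEN iffD1, rotated -1]) (use assms in \<open>auto simp: not_le\<close>)
qed

text \<open>The decreasing tuples are grouped by their largest entry. Each group is finite, and
  nonnegativity turns the iterated sum into an unordered one.\<close>

lemma mzv_eq_if_level_sums:
  assumes "s \<noteq> []" and "\<forall>a\<in>set s. 1 \<le> a" and "level (index_word s) sums S"
  shows "mzv s = S"
proof -
  obtain a t where s: "s = a # t"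
    using assms(1) by (cases s) auto
  let ?S = "\<lambda>b. {ns :: nat list. length ns = length t \<and> sorted_wrt (>) ns \<and> set ns \<subseteq> {1..b - 1}}"
  let ?f = "\<lambda>ns. \<Prod>i<length s. 1 / real (ns ! i) ^ (s ! i)"
  define g where "g = (\<lambda>b. zeta_sum (b - 1) t / real b ^ a)"
  have g: "(g has_sum S) {1..}"
    unfolding g_def using assms(2,3) unfolding s
    by (intro sums_imp_has_sum_atLeast_1[of "level (index_word s)"])
      (simp_all only: s level_index_word level_nonneg, simp)
  have inner: "((\<lambda>ns. ?f (b # ns)) has_sum g b) (?S b)" for b
  proof -
    have "(\<Sum>ns\<in>?S b. ?f (b # ns)) = g b"
      by (simp add: g_def s zeta_sum_def sum_divide_distrib prod.lessThan_Suc_shift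
          del: prod.lessThan_Suc)
    then show ?thesis
      by (simp add: has_sum_finiteI finite_lists_within del: One_nat_def)
  qed
  have "((\<lambda>(b, ns). ?f (b # ns)) has_sum S) (Sigma {1..} ?S)"
    using g inner
    by (intro has_sum_SigmaI[where g = g] summable_on_SigmaI[where g = g])
      (auto simp: has_sum_imp_summable intro!: prod_nonneg)
  moreover have "inj_on (\<lambda>(b, ns). b # ns) (Sigma {1..} ?S)"
    by (auto simp: inj_on_def)
  ultimately have "(?f has_sum S) ((\<lambda>(b, ns). b # ns) ` Sigma {1..} ?S)"
    by (subst has_sum_reindex) (simp_all add: o_def case_prod_unfold del: One_nat_def)
  moreover have "(\<lambda>(b, ns). b # ns) ` Sigma {1..} ?S =
      {ns. length ns = length s \<and> sorted_wrt (>) ns \<and> (\<forall>a\<in>set ns. 1 \<le> a)}"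
    by (auto simp: s length_Suc_conv image_iff subset_iff) force+
  ultimately show ?thesis
    unfolding mzv_def by (simp add: infsumI)
qed

section \<open>Duality\<close>

text \<open>As a conditional simp rule this one makes the simplifier diverge on equations between series
  in \<^typ>\<open>ennreal\<close>.\<close>

declare suminf_ennreal [simp del]

lemma suminf_swap_ennreal:
  fixes f :: "nat \<Rightarrow> nat \<Rightarrow> ennreal"
  shows "(\<Sum>m. \<Sum>n. f m n) = (\<Sum>n. \<Sum>m. f m n)"
  by (subst (1 3) nn_integral_count_space_nat[symmetric]) (simp add: nn_integral_suminf)

text \<open>Both sides run over the pairs n < b; in \<open>ennreal\<close> the exchange needs no
  convergence condition.\<close>

lemma suminf_triangle_ennreal:
  fixes f :: "nat \<Rightarrow> nat \<Rightarrow> ennreal"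
  shows "(\<Sum>n. \<Sum>b. f n (Suc (n + b))) = (\<Sum>b. \<Sum>n<b. f n b)"
proof -
  have "(\<Sum>b. f n (Suc (n + b))) = (\<Sum>b. if n < b then f n b else 0)" for n
    by (subst suminf_offset[of "\<lambda>b. if n < b then f n b else 0" "Suc n"]) (auto simp: add.commute)
  moreover have "(\<Sum>n. if n < b then f n b else 0) = (\<Sum>n<b. f n b)" for b
    by (subst suminf_finite[of "{..<b}"]) auto
  ultimately show ?thesis
    by (simp add: suminf_swap_ennreal[of "\<lambda>n b. if n < b then f n b else 0"])
qed

text \<open>The reciprocal of the binomial coefficient (m + n choose m).\<close>

definition connector :: "nat \<Rightarrow> nat \<Rightarrow> real" where
  "connector m n = fact m * fact n / fact (m + n)"

lemma connector_nonneg [simp]: "0 \<le> connector m n"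
  by (simp add: connector_def)

lemma connector_commute: "connector m n = connector n m"
  by (simp add: connector_def add.commute)

lemma connector_0 [simp]: "connector 0 n = 1"
  by (simp add: connector_def)

lemma connector_Suc: "connector m (Suc n) = connector m n * (real (Suc n) / real (Suc (m + n)))"
  by (simp add: connector_def field_simps)

lemma connector_le: "1 \<le> m \<Longrightarrow> connector m n \<le> 1 / real (Suc n)"
proof (induction m rule: dec_induct)
  case base
  have "fact (Suc n) = real (Suc n) * fact n"
    by simp
  then show ?case by (simp add: connector_def del: fact_Suc)
next
  case (step m)
  have "connector (Suc m) n = connector m n * (real (Suc m) / real (Suc (n + m)))"
    using connector_Suc[of n m] by (simp add: connector_commute)
  also have "\<dots> \<le> connector m n * 1"
    by (intro mult_left_mono) (auto simp: field_simps)
  finally show ?case using step by simp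
qed

text \<open>Every term is a difference of consecutive values of
  \<open>connector m b / real m\<close>, which tend to zero by \<open>connector_le\<close>.\<close>

lemma connector_sums:
  assumes "1 \<le> m"
  shows "(\<lambda>b. connector m (Suc (n + b)) / real (Suc (n + b))) sums (connector m n / real m)"
proof -
  have lim: "(\<lambda>b. connector m b) \<longlonglongrightarrow> 0"
    by (rule tendsto_sandwich[of "\<lambda>_. 0" _ _ "\<lambda>b. 1 / real (Suc b)"])
      (use connector_le[OF assms] LIMSEQ_inverse_real_of_nat in \<open>auto simp: inverse_eq_divide\<close>)
  have "(\<lambda>b. connector m (b + n) / real m) \<longlonglongrightarrow> 0 / real m"
    by (intro tendsto_divide tendsto_const LIMSEQ_ignore_initial_segment lim) (use assms in auto)
  then have "(\<lambda>b. connector m (b + n) / real m - connector m (Suc b + n) / real m) sums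
      (connector m (0 + n) / real m - 0 / real m)"
    by (rule telescope_sums')
  moreover have "connector m (b + n) / real m - connector m (Suc b + n) / real m =
      connector m (Suc (n + b)) / real (Suc (n + b))" for b
  proof -
    have "real (Suc (m + (b + n))) * connector m (Suc (b + n)) = connector m (b + n) * real (Suc (b + n))"
      unfolding connector_Suc by simp
    then show ?thesis
      using assms by (simp add: field_simps add_ac)
  qed
  ultimately show ?thesis by simp
qed

definition connected_sum :: "letter list \<Rightarrow> letter list \<Rightarrow> ennreal" where
  "connected_sum u w = (\<Sum>m. \<Sum>n. ennreal (level u m * level w n * connector m n))"

lemma connected_sum_commute: "connected_sum u w = connected_sum w u"
  unfolding connected_sum_def
  by (subst suminf_swap_ennreal, intro arg_cong[of _ _ suminf] ext) (metis connector_commute mult.commute)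

lemma connected_sum_Nil: "connected_sum [] w = (\<Sum>n. ennreal (level w n))"
  unfolding connected_sum_def by (subst suminf_finite[of "{0}"]) auto

text \<open>Here \<open>u\<close> must be nonempty because the telescoping series \<open>connector_sums\<close> only holds for \<open>m > 0\<close>.\<close>

lemma connected_sum_transport:
  assumes "u \<noteq> []"
  shows "connected_sum (X # u) w = connected_sum u (Y # w)"
proof -
  have "(\<Sum>n. ennreal (level (X # u) m * level w n * connector m n)) =
      (\<Sum>b. ennreal (level u m * level (Y # w) b * connector m b))" for m
  proof (cases "m = 0")
    case True
    then show ?thesis using assms by simp
  next
    case False
    let ?h = "\<lambda>n b. level u m * level w n * (connector m b / real b)"
    \<comment> \<open>The factor 1/m of the moving \<open>X\<close> becomes a sum over b > n;
      exchanging sums leaves the sum over n < b that defines \<open>level (Y # w) b\<close>.\<close>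
    have "ennreal (level (X # u) m * level w n * connector m n) = (\<Sum>b. ennreal (?h n (Suc (n + b))))" for n
    proof -
      have "(\<lambda>b. ?h n (Suc (n + b))) sums (level u m * level w n * (connector m n / real m))"
        by (intro sums_mult connector_sums) (use False in auto)
      then have "(\<Sum>b. ennreal (?h n (Suc (n + b)))) =
          ennreal (level u m * level w n * (connector m n / real m))"
        by (intro suminf_ennreal_eq) auto
      then show ?thesis by simp
    qed
    then have "(\<Sum>n. ennreal (level (X # u) m * level w n * connector m n)) =
        (\<Sum>n. \<Sum>b. ennreal (?h n (Suc (n + b))))"
      by presburger
    also have "\<dots> = (\<Sum>b. \<Sum>n<b. ennreal (?h n b))"
      by (rule suminf_triangle_ennreal)
    also have "\<dots> = (\<Sum>b. ennreal (\<Sum>n<b. ?h n b))"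
      by simp
    also have "\<dots> = (\<Sum>b. ennreal (level u m * level (Y # w) b * connector m b))"
      by (simp add: sum_distrib_left sum_distrib_right sum_divide_distrib)
    finally show ?thesis .
  qed
  then show ?thesis
    unfolding connected_sum_def by presburger
qed

text \<open>Letters leave u one by one and arrive swapped on w: \<open>X\<close> by transport,
  \<open>Y\<close> by transport with the sides exchanged. The final \<open>Y\<close> of u keeps the
  left word nonempty when an \<open>X\<close> moves; nonempty w serves the other direction.\<close>

lemma connected_sum_dual:
  assumes "u = [] \<or> last u = Y" and "w \<noteq> []"
  shows "connected_sum u w = connected_sum [] (dual_word u @ w)"
  using assms
proof (induction u arbitrary: w)
  case Nil
  then show ?case by (simp add: dual_word_def)
next
  case (Cons a u)
  show ?case
  proof (cases a)
    case X
    then have "u \<noteq> []" "last u = Y"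
      using Cons.prems by (auto split: if_splits)
    then show ?thesis
      using X Cons.IH[of "Y # w"] by (simp add: connected_sum_transport dual_word_def)
  next
    case Y
    have "connected_sum (Y # u) w = connected_sum u (X # w)"
      using connected_sum_transport[OF Cons.prems(2), of u] by (metis connected_sum_commute)
    also have "\<dots> = connected_sum [] (dual_word u @ X # w)"
      using Cons.prems by (intro Cons.IH) (auto split: if_splits)
    finally show ?thesis
      using Y by (simp add: dual_word_def)
  qed
qed

lemma level_duality:
  assumes "w \<noteq> []" and "hd w = X" and "last w = Y"
  shows "(\<Sum>n. ennreal (level w n)) = (\<Sum>n. ennreal (level (dual_word w) n))"
proof -
  obtain u where w: "w = X # u" "u \<noteq> []" "last u = Y"
    using assms by (cases w) (auto split: if_splits)
  \<comment> \<open>The first \<open>X\<close> moves separately, since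
    \<open>connected_sum_dual\<close> needs a nonempty right word.\<close>
  have "connected_sum w [] = connected_sum u [Y]"
    using w by (simp add: connected_sum_transport)
  also have "\<dots> = connected_sum [] (dual_word w)"
    using w connected_sum_dual[of u "[Y]"] by (simp add: dual_word_def)
  finally show ?thesis
    by (metis connected_sum_Nil connected_sum_commute)
qed

section \<open>Tail sums\<close>

text \<open>The argument of \<open>tail_sum\<close> is a prefix of an admissible word read backwards: \<open>tail_sum w n\<close> is the
  sum over those variables of \<open>rev w\<close> that exceed \<open>n\<close>, trailing letters \<open>X\<close> contributing powers
  of \<open>1/n\<close>. Convergence requires \<open>rev w\<close> to begin with \<open>X\<close>, i.e. \<open>last w = X\<close>.\<close>

fun tail_sum :: "letter list \<Rightarrow> nat \<Rightarrow> real" where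
  "tail_sum [] n = 1"
| "tail_sum (X # w) n = tail_sum w n / real n"
| "tail_sum (Y # w) n = (\<Sum>b. tail_sum w (Suc (n + b)) / real (Suc (n + b)))"

lemma inverse_consecutive_sums:
  assumes "1 \<le> n"
  shows "(\<lambda>b. 1 / (real (n + b) * real (Suc (n + b)))) sums (1 / real n)"
proof -
  have "(\<lambda>b. 1 / real (b + n)) \<longlonglongrightarrow> 0"
    by (rule LIMSEQ_ignore_initial_segment) (rule lim_1_over_n)
  then have "(\<lambda>b. 1 / real (b + n) - 1 / real (Suc b + n)) sums (1 / real (0 + n) - 0)"
    by (rule telescope_sums')
  moreover have "1 / real (b + n) - 1 / real (Suc b + n) = 1 / (real (n + b) * real (Suc (n + b)))" for b
    using assms by (simp add: field_simps)
  ultimately show ?thesis by simp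
qed

text \<open>The bound 1/n reproduces itself: the sum of 1/b^2 over b > n is at most the telescoping
  sum of 1/((b - 1) b), which is 1/n.\<close>

lemma summable_tail:
  fixes f :: "nat \<Rightarrow> real"
  assumes "\<And>n. 1 \<le> n \<Longrightarrow> 0 \<le> f n \<and> f n \<le> 1 / real n"
  shows "summable (\<lambda>b. f (Suc (n + b)) / real (Suc (n + b)))"
    and "1 \<le> n \<Longrightarrow> (\<Sum>b. f (Suc (n + b)) / real (Suc (n + b))) \<le> 1 / real n"
proof -
  let ?g = "\<lambda>n b. f (Suc (n + b)) / real (Suc (n + b))"
  have le: "0 \<le> ?g n b \<and> ?g n b \<le> 1 / (real (n + b) * real (Suc (n + b)))" if "1 \<le> n" for n b
  proof -
    have "f (Suc (n + b)) \<le> 1 / real (Suc (n + b))"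
      using assms[of "Suc (n + b)"] by simp
    also have "\<dots> \<le> 1 / real (n + b)"
      using that by (intro divide_left_mono) auto
    finally have "?g n b \<le> 1 / real (n + b) / real (Suc (n + b))"
      by (intro divide_right_mono) auto
    then show ?thesis using assms by simp
  qed
  have summable: "summable (?g n)" if "1 \<le> n" for n
  proof (rule summable_comparison_test'[OF sums_summable[OF inverse_consecutive_sums[OF that]], of 0])
    show "norm (?g n b) \<le> 1 / (real (n + b) * real (Suc (n + b)))" for b
      using le[OF that, of b] by (simp only: real_norm_def abs_of_nonneg)
  qed
  \<comment> \<open>The comparison covers only n \<ge> 1; for n = 0 the series has just one more
    initial term than for n = 1.\<close>
  have "summable (?g 0)"
    using summable[of 1] summable_Suc_iff[of "?g 0"] by simp
  then show "summable (?g n)"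
    using summable[of n] by (cases "n = 0") auto
  show "suminf (?g n) \<le> 1 / real n" if "1 \<le> n"
    using le[OF that] sums_unique[OF inverse_consecutive_sums[OF that]]
      suminf_le[OF _ summable[OF that] sums_summable[OF inverse_consecutive_sums[OF that]]]
    by simp
qed

lemma tail_sum_bounds:
  assumes "w \<noteq> []" and "last w = X" and "1 \<le> n"
  shows "0 \<le> tail_sum w n \<and> tail_sum w n \<le> 1 / real n"
  using assms
proof (induction w arbitrary: n)
  case (Cons a w)
  show ?case
  proof (cases "w = []")
    case True
    then show ?thesis using Cons.prems by simp
  next
    case False
    then have IH: "0 \<le> tail_sum w n \<and> tail_sum w n \<le> 1 / real n" if "1 \<le> n" for n
      using Cons that by simp
    show ?thesis
    proof (cases a)
      case X
      have "tail_sum w n / real n \<le> tail_sum w n / 1"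
        using IH[OF Cons.prems(3)] Cons.prems(3) by (intro divide_left_mono) auto
      then show ?thesis using X IH[OF Cons.prems(3)] by simp
    next
      case Y
      then show ?thesis
        using summable_tail[of "tail_sum w" n, OF IH] Cons.prems(3) IH
        by (auto intro!: suminf_nonneg)
    qed
  qed
qed simp

lemma tail_sum_Y_summable:
  assumes "w \<noteq> []" and "last w = X"
  shows "summable (\<lambda>b. tail_sum w (Suc (n + b)) / real (Suc (n + b)))"
  by (rule summable_tail(1)) (rule tail_sum_bounds[OF assms])

lemma tail_sum_nonneg:
  assumes "w = [] \<or> last w = X"
  shows "0 \<le> tail_sum w n"
proof (cases "(w, n)" rule: tail_sum.cases)
  case (3 v)
  then have "v \<noteq> []" "last v = X"
    using assms by (auto split: if_splits)
  then show ?thesis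
    using 3 tail_sum_bounds[of v] tail_sum_Y_summable[of v]
    by (auto intro!: suminf_nonneg)
next
  case (2 v)
  then show ?thesis
    using assms tail_sum_bounds[of w n] by (cases "n = 0") auto
qed simp

text \<open>Summation over b > n in \<open>tail_sum\<close> is adjoint to summation over l < n in
  \<open>level\<close>, so the head of w can be moved to the front of v by exchanging sums.\<close>

lemma tail_sum_adjoint:
  assumes "w = [] \<or> last w = X"
  shows "(\<Sum>n. ennreal (tail_sum w n * level v n)) = (\<Sum>n. ennreal (level (rev w @ v) n))"
  using assms
proof (induction w arbitrary: v)
  case (Cons a w)
  show ?case
  proof (cases a)
    case X
    have "(\<Sum>n. ennreal (tail_sum (a # w) n * level v n)) = (\<Sum>n. ennreal (tail_sum w n * level (X # v) n))"
      using X by (intro arg_cong[of _ _ suminf] ext) simp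
    also have "\<dots> = (\<Sum>n. ennreal (level (rev w @ X # v) n))"
      using Cons.prems by (intro Cons.IH) (auto split: if_splits)
    finally show ?thesis
      using X by simp
  next
    case Y
    then have w: "w \<noteq> []" "last w = X"
      using Cons.prems by (auto split: if_splits)
    let ?h = "\<lambda>n b. tail_sum w b / real b * level v n"
    have "ennreal (tail_sum (Y # w) n * level v n) = (\<Sum>b. ennreal (?h n (Suc (n + b))))" for n
    proof -
      have "(\<lambda>b. ?h n (Suc (n + b))) sums (tail_sum (Y # w) n * level v n)"
        using tail_sum_Y_summable[OF w] by (simp only: tail_sum.simps) (intro sums_mult2 summable_sums)
      then show ?thesis
        using w by (intro suminf_ennreal_eq[symmetric]) (auto simp: tail_sum_nonneg)
    qed
    then have "(\<Sum>n. ennreal (tail_sum (Y # w) n * level v n)) =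
        (\<Sum>n. \<Sum>b. ennreal (?h n (Suc (n + b))))"
      by presburger
    also have "\<dots> = (\<Sum>b. \<Sum>n<b. ennreal (?h n b))"
      by (rule suminf_triangle_ennreal)
    also have "\<dots> = (\<Sum>b. ennreal (\<Sum>n<b. ?h n b))"
      using w by (simp add: tail_sum_nonneg)
    also have "\<dots> = (\<Sum>b. ennreal (tail_sum w b * level (Y # v) b))"
      by (simp add: sum_distrib_left sum_divide_distrib)
    also have "\<dots> = (\<Sum>n. ennreal (level (rev w @ Y # v) n))"
      using w by (intro Cons.IH) simp
    finally show ?thesis
      using Y by simp
  qed
qed simp

text \<open>Pairing with the empty word, whose level is concentrated at 0, extracts the value of
  \<open>tail_sum\<close> at 0 in \<open>tail_sum_adjoint\<close>.\<close>

lemma mzv_eq_tail_sum: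
  assumes "s \<noteq> []" and "\<forall>a\<in>set s. 1 \<le> a"
    and "index_word s = rev (Y # w)" and "w \<noteq> []" and "last w = X"
  shows "mzv s = tail_sum (Y # w) 0"
proof (rule mzv_eq_if_level_sums[OF assms(1,2)])
  have nonneg: "0 \<le> tail_sum (Y # w) 0"
    using assms by (intro tail_sum_nonneg) simp
  have "(\<Sum>n. ennreal (level (index_word s) n)) = (\<Sum>n. ennreal (tail_sum (Y # w) n * level [] n))"
    unfolding assms(3) using assms by (subst tail_sum_adjoint) (auto)
  also have "\<dots> = ennreal (tail_sum (Y # w) 0)"
    by (subst suminf_finite[of "{0}"]) auto
  finally show "level (index_word s) sums tail_sum (Y # w) 0"
    using nonneg sums_ennreal[of "level (index_word s)" "tail_sum (Y # w) 0"]
    by (metis level_nonneg summableI summable_sums)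
qed

section \<open>Expansion of tail sums into star sums\<close>

text \<open>The counterpart of \<open>tail_sum\<close> for b \<le> n. With f left free, words act as
  linear operators and concatenation is composition.\<close>

fun star_op :: "letter list \<Rightarrow> (nat \<Rightarrow> real) \<Rightarrow> nat \<Rightarrow> real" where
  "star_op [] f n = f n"
| "star_op (X # v) f n = star_op v f n / real n"
| "star_op (Y # v) f n = (\<Sum>b=1..n. star_op v f b / real b)"

lemma star_op_append: "star_op (v @ w) f = star_op v (star_op w f)"
proof
  show "star_op (v @ w) f n = star_op v (star_op w f) n" for n
    by (induction v f n rule: star_op.induct) auto
qed

lemma star_op_add: "star_op v (\<lambda>n. f n + g n) n = star_op v f n + star_op v g n"
  by (induction v f n rule: star_op.induct) (auto simp: add_divide_distrib sum.distrib)

lemma star_op_cmult: "star_op v (\<lambda>n. c * f n) n = c * star_op v f n"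
  by (induction v f n rule: star_op.induct) (auto simp: sum_distrib_left)

lemma star_op_sum: "finite I \<Longrightarrow> star_op v (\<lambda>n. \<Sum>i\<in>I. f i n) n = (\<Sum>i\<in>I. star_op v (f i) n)"
proof (induction I rule: finite_induct)
  case empty
  then show ?case using star_op_cmult[of v 0 "\<lambda>_. 0" n] by simp
qed (simp add: star_op_add)

lemma star_op_replicate_X: "star_op (replicate c X @ v) f n = star_op v f n / real n ^ c"
  by (induction c) (auto simp: field_simps)

lemma star_op_nonneg: "(\<And>n. 0 \<le> f n) \<Longrightarrow> 0 \<le> star_op v f n"
  by (induction v f n rule: star_op.induct) (auto intro!: sum_nonneg divide_nonneg_nonneg)

text \<open>With an upper bound n the summation precedes the power, so an entry a is read as Y
  X^(a-1) instead of X^(a-1) Y; moving the last \<open>Y\<close> to the front achieves this.\<close>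

lemma zeta_star_sum_eq_star_op:
  assumes "\<forall>a\<in>set s. 1 \<le> a"
  shows "zeta_star_sum n s = star_op (butlast (Y # index_word s)) (\<lambda>_. 1) n"
  using assms
proof (induction s arbitrary: n)
  case (Cons a s)
  obtain c where a: "a = Suc c"
    using Cons.prems by (cases a) auto
  have "butlast (Y # index_word (a # s)) = Y # replicate c X @ butlast (Y # index_word s)"
    by (simp add: a butlast_append)
  then show ?case
    using Cons a by (simp add: zeta_star_sum_Cons star_op_replicate_X mult.commute del: butlast.simps)
qed simp

lemma zeta_star_lead_eq_star_op:
  assumes "s \<noteq> []" and "\<forall>a\<in>set s. 1 \<le> a"
  shows "zeta_star_lead n s = star_op (butlast (index_word s)) (\<lambda>_. 1) n"
proof -
  obtain a t where s: "s = a # t"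
    using assms(1) by (cases s) auto
  obtain c where a: "a = Suc c"
    using assms(2) s by (cases a) auto
  have "butlast (index_word s) = replicate c X @ butlast (Y # index_word t)"
    by (simp add: a s butlast_append)
  moreover have "real n powi (1 - int a) = 1 / real n ^ c"
    by (simp add: a power_int_minus inverse_eq_divide)
  ultimately show ?thesis
    using assms(2)
    by (simp add: zeta_star_lead_def s zeta_star_sum_eq_star_op star_op_replicate_X del: butlast.simps)
qed

lemma tail_sum_Y:
  assumes "w \<noteq> []" and "last w = X"
  shows "tail_sum (Y # w) n = tail_sum (Y # w) 0 - star_op [Y] (tail_sum w) n"
proof -
  let ?f = "\<lambda>b. tail_sum w (Suc b) / real (Suc b)"
  have "suminf ?f = (\<Sum>b. ?f (b + n)) + sum ?f {..<n}"
    using tail_sum_Y_summable[OF assms, of 0] by (intro suminf_split_initial_segment) simp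
  moreover have "sum ?f {..<n} = star_op [Y] (tail_sum w) n"
    by (simp add: sum.atLeast1_atMost_eq)
  ultimately show ?thesis
    by (simp add: add.commute)
qed

lemma tail_sum_replicate_X: "tail_sum (replicate c X @ w) = star_op (replicate c X) (tail_sum w)"
  by (rule ext, induction c) auto

text \<open>Iterates \<open>tail_sum_Y\<close>: every split leaves a constant, the value at 0, and
  reverses the sign of what is still to be expanded.\<close>

lemma tail_sum_replicate_Y:
  assumes "w \<noteq> []" and "last w = X"
  shows "tail_sum (replicate q Y @ w) n =
    (\<Sum>j<q. (- 1) ^ j * tail_sum (replicate (q - j) Y @ w) 0 * star_op (replicate j Y) (\<lambda>_. 1) n) +
    (- 1) ^ q * star_op (replicate q Y) (tail_sum w) n"
proof (induction q arbitrary: n)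
  case (Suc q)
  let ?c = "\<lambda>j. (- 1) ^ j * tail_sum (replicate (q - j) Y @ w) 0"
  have Y: "star_op [Y] (star_op (replicate j Y) f) n = star_op (replicate (Suc j) Y) f n" for j f
    by simp
  have "star_op [Y] (tail_sum (replicate q Y @ w)) n =
      star_op [Y] (\<lambda>n. (\<Sum>j<q. ?c j * star_op (replicate j Y) (\<lambda>_. 1) n) +
        (- 1) ^ q * star_op (replicate q Y) (tail_sum w) n) n"
    using Suc.IH by presburger
  also have "\<dots> = (\<Sum>j<q. ?c j * star_op (replicate (Suc j) Y) (\<lambda>_. 1) n) +
        (- 1) ^ q * star_op (replicate (Suc q) Y) (tail_sum w) n"
    unfolding star_op_add star_op_cmult Y by (simp only: star_op_sum[OF finite_lessThan] star_op_cmult Y)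
  finally have step: "star_op [Y] (tail_sum (replicate q Y @ w)) n = \<dots>" .
  have "tail_sum (replicate (Suc q) Y @ w) n =
      tail_sum (replicate (Suc q) Y @ w) 0 - star_op [Y] (tail_sum (replicate q Y @ w)) n"
    using tail_sum_Y[of "replicate q Y @ w" n] assms by simp
  \<comment> \<open>The new constant is the summand j = 0; the old summands move up by one because
    of the additional summation.\<close>
  then show ?case
    unfolding step sum.lessThan_Suc_shift by (simp add: sum_negf del: tail_sum.simps star_op.simps(3))
qed simp

section \<open>Words composed of blocks\<close>

definition block :: "(nat \<Rightarrow> nat) \<Rightarrow> (nat \<Rightarrow> nat) \<Rightarrow> nat \<Rightarrow> letter list" where
  "block p m j = replicate (p j) Y @ replicate (m j) X"

text \<open>The bound l is exclusive. For i = 1 and l = k + 1 this is the dual of the word of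
  \<open>pmv_index p m k\<close>, read backwards as \<open>tail_sum\<close> expects.\<close>

definition blocks :: "(nat \<Rightarrow> nat) \<Rightarrow> (nat \<Rightarrow> nat) \<Rightarrow> nat \<Rightarrow> nat \<Rightarrow> letter list" where
  "blocks p m i l = concat (map (block p m) [i..<l])"

lemma blocks_Cons: "i < l \<Longrightarrow> blocks p m i l = replicate (p i) Y @ replicate (m i) X @ blocks p m (Suc i) l"
  by (simp add: blocks_def block_def upt_conv_Cons)

lemma blocks_snoc: "i \<le> l \<Longrightarrow> blocks p m i (Suc l) = blocks p m i l @ replicate (p l) Y @ replicate (m l) X"
  by (simp add: blocks_def block_def)

lemma blocks_Nil [simp]: "blocks p m i i = []"
  by (simp add: blocks_def)

lemma last_blocks:
  assumes "1 \<le> i" and "i \<le> k" and "1 \<le> m k"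
  shows "replicate (m i) X @ blocks p m (Suc i) (Suc k) \<noteq> []"
    and "last (replicate (m i) X @ blocks p m (Suc i) (Suc k)) = X"
  using assms by (cases "i = k"; simp add: blocks_snoc last_append)+

text \<open>Induction on the number l of expanded blocks: the last summand carries the unexpanded
  rest, and its sign counts the letters \<open>Y\<close> already passed.\<close>

lemma tail_sum_blocks:
  assumes "1 \<le> m k" and "l \<le> k"
  shows "tail_sum (blocks p m 1 (Suc k)) n =
    (\<Sum>i=1..l. (- 1) ^ (\<Sum>a=1..i-1. p a) *
      (\<Sum>j<p i. (- 1) ^ j *
        tail_sum (replicate (p i - j) Y @ replicate (m i) X @ blocks p m (Suc i) (Suc k)) 0 *
        star_op (blocks p m 1 i @ replicate j Y) (\<lambda>_. 1) n)) +
    (- 1) ^ (\<Sum>a=1..l. p a) *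
      star_op (blocks p m 1 (Suc l)) (tail_sum (blocks p m (Suc l) (Suc k))) n"
  using assms(2)
proof (induction l)
  case (Suc l)
  let ?q = "p (Suc l)" and ?U = "blocks p m 1 (Suc l)"
    and ?w = "replicate (m (Suc l)) X @ blocks p m (Suc (Suc l)) (Suc k)"
  have tail: "tail_sum (blocks p m (Suc l) (Suc k)) = (\<lambda>n.
    (\<Sum>j<?q. ((- 1) ^ j * tail_sum (replicate (?q - j) Y @ ?w) 0) * star_op (replicate j Y) (\<lambda>_. 1) n) +
    (- 1) ^ ?q * star_op (replicate ?q Y) (tail_sum ?w) n)"
    using Suc.prems last_blocks[of "Suc l" k m p] assms(1)
    by (intro ext) (simp add: blocks_Cons[of "Suc l"] tail_sum_replicate_Y del: replicate_Suc)
  have "star_op ?U (tail_sum (blocks p m (Suc l) (Suc k))) n =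
    (\<Sum>j<?q. (- 1) ^ j * tail_sum (replicate (?q - j) Y @ ?w) 0 *
        star_op (?U @ replicate j Y) (\<lambda>_. 1) n) +
    (- 1) ^ ?q * star_op (blocks p m 1 (Suc (Suc l))) (tail_sum (blocks p m (Suc (Suc l)) (Suc k))) n"
    unfolding tail star_op_add star_op_cmult star_op_sum[OF finite_lessThan]
    by (simp add: blocks_snoc star_op_append tail_sum_replicate_X)
  then show ?case
    using Suc by (simp add: power_add algebra_simps)
qed simp

section \<open>Convergence of Kaneko--Yamamoto values\<close>

text \<open>Since \<open>1/4 + 1/4 < 1\<close>, growth of order \<open>n\<^bsup>1/4\<^esup>\<close> of both harmonic factors makes the
  Kaneko--Yamamoto series converge; any exponent below \<open>1/2\<close> would do, and \<open>1/4\<close> allows the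
  algebraic identity for \<open>x\<^sup>4 - y\<^sup>4\<close> instead of calculus.\<close>

lemma sum_powr_le: "(\<Sum>b=1..n. real b powr (-3/4)) \<le> 4 * real n powr (1/4)"
proof (induction n)
  case (Suc n)
  define x where "x = real (Suc n) powr (1/4)"
  define y where "y = real n powr (1/4)"
  have x: "x > 0" "x ^ 4 = real (Suc n)" and y: "y \<ge> 0" "y ^ 4 = real n"
    by (cases "n = 0"; simp add: x_def y_def powr_power)+
  have "y \<le> x"
    unfolding x_def y_def by (intro powr_mono2) auto
  have "real (Suc n) powr (-3/4) = 1 / x ^ 3"
    by (simp add: x_def powr_power powr_minus_divide)
  moreover have "4 * y + 1 / x ^ 3 \<le> 4 * x"
  proof -
    have "1 = x ^ 4 - y ^ 4"
      using x y by simp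
    also have "\<dots> = (x - y) * (x ^ 3 + x ^ 2 * y + x * y ^ 2 + y ^ 3)"
      by (simp add: algebra_simps power2_eq_square power3_eq_cube power4_eq_xxxx)
    also have "\<dots> \<le> (x - y) * (x ^ 3 + x ^ 2 * x + x * x ^ 2 + x ^ 3)"
      using \<open>y \<le> x\<close> x y by (intro mult_left_mono add_mono power_mono) auto
    also have "\<dots> = 4 * (x - y) * x ^ 3"
      by (simp add: algebra_simps power2_eq_square power3_eq_cube)
    finally show ?thesis
      using x by (simp add: field_simps)
  qed
  ultimately show ?case
    using Suc by (simp add: x_def y_def)
qed simp

text \<open>The induction step for the letter \<open>Y\<close> in both growth estimates below, with
  the factor 4 from \<open>sum_powr_le\<close>.\<close>

lemma weighted_sum_powr_le:
  fixes f :: "nat \<Rightarrow> real"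
  assumes "\<And>b. 1 \<le> b \<Longrightarrow> f b \<le> C * real b powr (1/4)" and "0 \<le> C"
  shows "(\<Sum>b=1..n. f b / real b) \<le> 4 * C * real n powr (1/4)"
proof -
  have "(\<Sum>b=1..n. f b / real b) \<le> (\<Sum>b=1..n. C * real b powr (-3/4))"
  proof (rule sum_mono)
    fix b assume "b \<in> {1..n}"
    then have b: "1 \<le> b" by simp
    have "real b powr (-3/4) = real b powr (1/4 - 1)"
      by simp
    also have "\<dots> = real b powr (1/4) / real b"
      using b by (subst powr_diff) simp
    finally show "f b / real b \<le> C * real b powr (-3/4)"
      using divide_right_mono[OF assms(1)[OF b], of "real b"] by simp
  qed
  also have "\<dots> \<le> C * (4 * real n powr (1/4))"
    using assms(2) sum_powr_le by (simp add: mult_left_mono flip: sum_distrib_left)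
  finally show ?thesis by simp
qed

lemma star_op_growth: "\<exists>C\<ge>0. \<forall>n\<ge>1. star_op v (\<lambda>_. 1) n \<le> C * real n powr (1/4)"
proof (induction v)
  case Nil
  show ?case by (rule exI[of _ 1]) (auto simp: ge_one_powr_ge_zero)
next
  case (Cons a v)
  then obtain C where C: "C \<ge> 0" "\<And>n. 1 \<le> n \<Longrightarrow> star_op v (\<lambda>_. 1) n \<le> C * real n powr (1/4)"
    by auto
  show ?case
  proof (cases a)
    case X
    have "star_op v (\<lambda>_. 1) n / real n \<le> C * real n powr (1/4)" if "1 \<le> n" for n
    proof -
      have "star_op v (\<lambda>_. 1) n / real n \<le> star_op v (\<lambda>_. 1) n / 1"
        using that by (intro divide_left_mono star_op_nonneg) auto
      then show ?thesis using C(2)[OF that] by simp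
    qed
    then show ?thesis using X C(1) by auto
  next
    case Y
    then show ?thesis
      using weighted_sum_powr_le[of "star_op v (\<lambda>_. 1)" C] C
      by (intro exI[of _ "4 * C"]) auto
  qed
qed

lemma sum_level_growth: "\<exists>C\<ge>0. \<forall>n\<ge>1. (\<Sum>l<n. level w l) \<le> C * real n powr (1/4)"
proof (induction w)
  case Nil
  have "(\<Sum>l<n. level [] l) \<le> 1 * real n powr (1/4)" if "1 \<le> n" for n
  proof -
    have "(\<Sum>l<n. level [] l) = (\<Sum>l\<in>{0::nat}. 1)"
      using that by (intro sum.mono_neutral_cong_right) auto
    then show ?thesis using that by (simp add: ge_one_powr_ge_zero)
  qed
  then show ?case by (intro exI[of _ 1]) auto
next
  case (Cons a w)
  then obtain C where C: "C \<ge> 0" "\<And>n. 1 \<le> n \<Longrightarrow> (\<Sum>l<n. level w l) \<le> C * real n powr (1/4)"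
    by auto
  show ?case
  proof (cases a)
    case X
    have "(\<Sum>l<n. level (X # w) l) \<le> C * real n powr (1/4)" if "1 \<le> n" for n
    proof -
      have "level (X # w) l \<le> level w l" for l
        using divide_left_mono[of 1 "real l" "level w l"] by (cases "l = 0") auto
      then have "(\<Sum>l<n. level (X # w) l) \<le> (\<Sum>l<n. level w l)"
        by (intro sum_mono)
      then show ?thesis using C(2)[OF that] by simp
    qed
    then show ?thesis using X C(1) by auto
  next
    case Y
    have "(\<Sum>l<n. level (Y # w) l) \<le> 4 * C * real n powr (1/4)" if "1 \<le> n" for n
    proof -
      have "(\<Sum>l<n. level (Y # w) l) \<le> (\<Sum>l=0..n. level (Y # w) l)"
        by (intro sum_mono2 level_nonneg) auto
      also have "\<dots> = (\<Sum>l=1..n. (\<Sum>i<l. level w i) / real l)"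
        by (simp add: sum.atLeast_Suc_atMost)
      finally show ?thesis
        using weighted_sum_powr_le[of "\<lambda>l. \<Sum>i<l. level w i" C n] C by simp
    qed
    then show ?thesis using Y C(1) by (intro exI[of _ "4 * C"]) auto
  qed
qed

text \<open>Two factors of order n^(1/4) against n^(-a) with a \<ge> 2 leave at most the order
  n^(-3/2).\<close>

lemma star_op_level_summable:
  assumes "2 \<le> a"
  shows "summable (\<lambda>n. star_op v (\<lambda>_. 1) n * level (index_word (a # s)) n)"
proof -
  obtain C where C: "C \<ge> 0" "\<And>n. 1 \<le> n \<Longrightarrow> star_op v (\<lambda>_. 1) n \<le> C * real n powr (1/4)"
    using star_op_growth by blast
  obtain D where D: "D \<ge> 0" "\<And>n. 1 \<le> n \<Longrightarrow> (\<Sum>l<n. level (index_word s) l) \<le> D * real n powr (1/4)"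
    using sum_level_growth by blast
  have "norm (star_op v (\<lambda>_. 1) n * level (index_word (a # s)) n) \<le> C * D * real n powr (-3/2)"
    if n: "1 \<le> n" for n
  proof -
    have "level (index_word (a # s)) n \<le> (D * real n powr (1/4)) / real n ^ 2"
      unfolding level_index_word_Cons[OF order.trans[OF one_le_numeral assms]]
      using n assms D by (intro frac_le power_increasing sum_nonneg) auto
    then have "star_op v (\<lambda>_. 1) n * level (index_word (a # s)) n \<le>
        (C * real n powr (1/4)) * ((D * real n powr (1/4)) / real n ^ 2)"
      using C n by (intro mult_mono) auto
    also have "\<dots> = C * D * (real n powr (1/4) * real n powr (1/4) / real n powr 2)"
      using n by (simp add: powr_numeral)
    also have "real n powr (1/4) * real n powr (1/4) / real n powr 2 = real n powr (-3/2)"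
    proof -
      have "real n powr (1/4) * real n powr (1/4) / real n powr 2 = real n powr (1/4 + 1/4 - 2)"
        by (simp only: powr_add powr_diff)
      then show ?thesis by simp
    qed
    finally show ?thesis
      by (simp add: abs_mult star_op_nonneg)
  qed
  moreover have "summable (\<lambda>n. C * D * real n powr (-3/2))"
    by (intro summable_mult) (simp add: summable_real_powr_iff)
  ultimately show ?thesis
    by (rule summable_comparison_test'[of _ 1, rotated])
qed

lemma star_op_level_sums_ky_value:
  assumes "2 \<le> a" and "\<forall>b\<in>set t. 1 \<le> b" and "s \<noteq> []" and "\<forall>b\<in>set s. 1 \<le> b"
    and "butlast (index_word s) = v"
  shows "(\<lambda>n. star_op v (\<lambda>_. 1) n * level (index_word (a # t)) n) sums ky_value (a # t) s"
proof -
  let ?f = "\<lambda>n. star_op v (\<lambda>_. 1) n * level (index_word (a # t)) n"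
  have sums: "?f sums suminf ?f"
    using star_op_level_summable[OF assms(1)] by (rule summable_sums)
  have "((\<lambda>n. zeta_sum (n - 1) (tl (a # t)) * zeta_star_lead n s / real n ^ hd (a # t))
      has_sum suminf ?f) {1..}"
  proof (rule sums_imp_has_sum_atLeast_1[OF sums])
    fix n :: nat assume "1 \<le> n"
    then have "level (index_word (a # t)) n = zeta_sum (n - 1) t / real n ^ a"
      using assms by (intro level_index_word) auto
    then show "zeta_sum (n - 1) (tl (a # t)) * zeta_star_lead n s / real n ^ hd (a # t) = ?f n"
      using assms(3-5) by (simp add: zeta_star_lead_eq_star_op)
  qed (auto simp: star_op_nonneg)
  then have "ky_value (a # t) s = suminf ?f"
    unfolding ky_value_def by (rule infsumI)
  then show ?thesis using sums by simp
qed

section \<open>The index words of the theorem\<close>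

lemma index_word_pmv:
  assumes "1 \<le> k" and "1 \<le> m k"
  shows "index_word (pmv_index p m k) = map swap_letter (blocks p m 1 (Suc k))"
proof -
  have "replicate (p 1) X @ concat (map (\<lambda>j. replicate (m j) Y @ replicate (p (j + 1)) X) [1..<k]) @
      replicate (m k) Y = map swap_letter (blocks p m 1 (Suc k))"
    using assms(1) by (induction k rule: dec_induct) (simp_all add: blocks_snoc)
  moreover have "Y # replicate (m k - 1) Y = replicate (m k) Y"
    using assms(2) by (cases "m k") auto
  ultimately show ?thesis
    by (simp add: pmv_index_def index_word_box o_def case_prod_unfold)
qed

lemma kv_index_eq_pmv_index: "kv_index \<kappa> r = pmv_index (\<lambda>_. 1) \<kappa> r"
  by (simp add: kv_index_def pmv_index_def numeral_2_eq_2)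

lemma dual_map_swap_letter: "dual_word (map swap_letter w) = rev w"
proof -
  have "swap_letter \<circ> swap_letter = id"
    by (rule ext) (metis comp_apply id_apply swap_letter.elims swap_letter.simps)
  then show ?thesis by (simp add: dual_word_def)
qed

text \<open>Reversal turns the block Y X^(k_a) into X^(k_a) Y, the word of the entry k_a +
  1.\<close>

lemma rev_blocks_one:
  "rev (blocks (\<lambda>_. 1) \<kappa> 1 (Suc r)) = index_word (map (\<lambda>a. \<kappa> a + 1) (rev [1..<r+1]))"
  by (induction r) (simp_all add: blocks_snoc)

lemma index_word_E:
  assumes "i \<le> k"
  shows "index_word (E_index p m k i) = rev (Y # replicate (m i) X @ blocks p m (Suc i) (Suc k))"
proof -
  have "replicate (m k) X @ concat (map (\<lambda>j. replicate (p (j + 1)) Y @ replicate (m j) X) (rev [i..<k])) =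
      rev (replicate (m i) X @ blocks p m (Suc i) (Suc k))"
    using assms by (induction k rule: dec_induct) (simp_all add: blocks_snoc)
  then show ?thesis
    by (simp add: E_index_def index_word_box o_def case_prod_unfold)
qed

lemma index_word_lead_F: "index_word (lead_F_index p m i) = blocks p m 1 i @ [Y]"
  by (simp add: lead_F_index_def index_word_box o_def case_prod_unfold blocks_def block_def[abs_def])

lemma index_pos:
  "\<forall>a\<in>set (pmv_index p m k). 1 \<le> a"
  "\<forall>a\<in>set (E_index p m k i). 1 \<le> a"
  "\<forall>a\<in>set (lead_F_index p m i). 1 \<le> a"
  unfolding pmv_index_def E_index_def lead_F_index_def
  using box_pos[of "p 1 + 1" "map (\<lambda>j. (m j, p (j + 1) + 1)) [1..<k]"]
    box_pos[of "m k + 1" "map (\<lambda>j. (p (j + 1), m j + 1)) (rev [i..<k])"]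
    box_pos[of 1 "map (\<lambda>j. (p j, m j + 1)) [1..<i]"]
  by auto

lemma index_not_Nil:
  "pmv_index p m k \<noteq> []" "E_index p m k i \<noteq> []" "lead_F_index p m i \<noteq> []"
  by (simp_all add: pmv_index_def E_index_def lead_F_index_def)

text \<open>Identifies the constants of \<open>tail_sum_blocks\<close>: of the p_i - j remaining
  letters \<open>Y\<close>, one closes the last entry of E'_i and the others are the appended
  ones.\<close>

lemma mzv_E_index:
  assumes "1 \<le> i" and "i \<le> k" and "1 \<le> m k" and "j < p i"
  shows "mzv (E_index p m k i @ replicate (p i - Suc j) 1) =
    tail_sum (replicate (p i - j) Y @ replicate (m i) X @ blocks p m (Suc i) (Suc k)) 0"
proof -
  have q: "p i - j = Suc (p i - Suc j)"
    using assms by simp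
  show ?thesis
    unfolding q replicate_Suc append_Cons
    by (rule mzv_eq_tail_sum)
      (use assms last_blocks[of i k m p] index_pos in
        \<open>auto simp: index_not_Nil index_word_E replicate_append_same[symmetric]\<close>)
qed

theorem theorem5p2:
  fixes k r :: nat and p m \<kappa> :: "nat \<Rightarrow> nat"
  assumes "1 \<le> k" and "1 \<le> r" and "1 \<le> m k" and "1 \<le> \<kappa> r"
  shows "mzv (kv_index \<kappa> r @ pmv_index p m k) =
    (\<Sum>i=1..k. (- 1) ^ (\<Sum>a=1..i-1. p a) *
      (\<Sum>j=1..p i. (- 1) ^ (j - 1) * mzv (E_index p m k i @ replicate (p i - j) 1) *
        ky_value (map (\<lambda>a. \<kappa> a + 1) (rev [1..<r+1]))
                 (lead_F_index p m i @ replicate (j - 1) 1)))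
    + (- 1) ^ (\<Sum>a=1..k. p a) *
      ky_value (map (\<lambda>a. \<kappa> a + 1) (rev [1..<r+1])) (lead_F_index p m (k + 1))"
    (is "_ = ?rhs")
proof -
  let ?ks = "map (\<lambda>a. \<kappa> a + 1) (rev [1..<r+1])"
  let ?w = "blocks p m 1 (Suc k)" and ?s = "kv_index \<kappa> r @ pmv_index p m k"
  have ks: "?ks = (\<kappa> r + 1) # map (\<lambda>a. \<kappa> a + 1) (rev [1..<r])"
    using assms(2) by simp
  have ky: "(\<lambda>n. star_op (blocks p m 1 i @ replicate j Y) (\<lambda>_. 1) n * level (index_word ?ks) n) sums
      ky_value ?ks (lead_F_index p m i @ replicate j 1)" for i j
    unfolding ks
  proof (rule star_op_level_sums_ky_value)
    show "butlast (index_word (lead_F_index p m i @ replicate j 1)) = blocks p m 1 i @ replicate j Y"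
      by (simp add: index_word_lead_F butlast_append replicate_append_same[symmetric] flip: replicate_Suc)
  qed (use assms index_pos index_not_Nil in auto)
  \<comment> \<open>The last summand gets an empty power of \<open>Y\<close> to match the shape of
    \<open>ky\<close>.\<close>
  have tail_w: "tail_sum ?w n = (\<Sum>i=1..k. (- 1) ^ (\<Sum>a=1..i-1. p a) *
      (\<Sum>j<p i. (- 1) ^ j * mzv (E_index p m k i @ replicate (p i - Suc j) 1) *
        star_op (blocks p m 1 i @ replicate j Y) (\<lambda>_. 1) n)) +
      (- 1) ^ (\<Sum>a=1..k. p a) * star_op (blocks p m 1 (Suc k) @ replicate 0 Y) (\<lambda>_. 1) n" for n
  proof -
    have Nil: "tail_sum (blocks p m (Suc k) (Suc k)) = (\<lambda>_. 1)"
      by (rule ext) simp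
    show ?thesis
      unfolding tail_sum_blocks[of m k k, OF assms(3) order.refl] Nil
      using assms by (auto simp: mzv_E_index[unfolded One_nat_def] intro!: sum.cong)
  qed
  have sums: "(\<lambda>n. tail_sum ?w n * level (index_word ?ks) n) sums
     ((\<Sum>i=1..k. (- 1) ^ (\<Sum>a=1..i-1. p a) *
      (\<Sum>j<p i. (- 1) ^ j * mzv (E_index p m k i @ replicate (p i - Suc j) 1) *
        ky_value ?ks (lead_F_index p m i @ replicate j 1))) +
      (- 1) ^ (\<Sum>a=1..k. p a) * ky_value ?ks (lead_F_index p m (Suc k) @ replicate 0 1))"
    unfolding tail_w distrib_right sum_distrib_right mult.assoc
    by (intro sums_add sums_sum sums_mult ky[unfolded mult.assoc])
  also have "(\<Sum>i=1..k. (- 1) ^ (\<Sum>a=1..i-1. p a) *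
      (\<Sum>j<p i. (- 1) ^ j * mzv (E_index p m k i @ replicate (p i - Suc j) 1) *
        ky_value ?ks (lead_F_index p m i @ replicate j 1))) +
      (- 1) ^ (\<Sum>a=1..k. p a) * ky_value ?ks (lead_F_index p m (Suc k) @ replicate 0 1) = ?rhs"
    by (simp add: sum.atLeast1_atMost_eq)
  finally have sums: "(\<lambda>n. tail_sum ?w n * level (index_word ?ks) n) sums ?rhs" .
  have w: "?w = [] \<or> last ?w = X"
    using assms by (auto simp: blocks_snoc last_append)
  have word: "index_word ?s = map swap_letter (blocks (\<lambda>_. 1) \<kappa> 1 (Suc r) @ ?w)"
    using assms by (simp add: kv_index_eq_pmv_index index_word_pmv)
  have "(\<Sum>n. ennreal (level (index_word ?s) n)) = (\<Sum>n. ennreal (level (dual_word (index_word ?s)) n))"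
  proof (rule level_duality)
    show "hd (index_word ?s) = X" "index_word ?s \<noteq> []"
      unfolding word using assms by (simp_all add: blocks_Cons)
    show "last (index_word ?s) = Y"
      unfolding word using assms by (simp add: blocks_snoc last_append)
  qed
  also have "dual_word (index_word ?s) = rev ?w @ index_word ?ks"
    unfolding word dual_map_swap_letter by (simp only: rev_append rev_blocks_one)
  also have "(\<Sum>n. ennreal (level (rev ?w @ index_word ?ks) n)) =
      (\<Sum>n. ennreal (tail_sum ?w n * level (index_word ?ks) n))"
    using tail_sum_adjoint[OF w] by simp
  also have "\<dots> = ennreal ?rhs"
    using sums w by (intro suminf_ennreal_eq) (auto simp: tail_sum_nonneg)
  finally have "(\<Sum>n. ennreal (level (index_word ?s) n)) = ennreal ?rhs" .
  \<comment> \<open>\<open>ennreal\<close> sends negative reals to 0, so returning to real series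
    requires this sign.\<close>
  moreover have "0 \<le> ?rhs"
    using sums w by (intro sums_le[OF _ sums_zero sums]) (auto simp: tail_sum_nonneg)
  ultimately have "level (index_word ?s) sums ?rhs"
    using sums_ennreal[of "level (index_word ?s)" ?rhs] by (metis level_nonneg summableI summable_sums)
  then show ?thesis
    by (intro mzv_eq_if_level_sums) (use index_pos index_not_Nil in \<open>auto simp: kv_index_eq_pmv_index\<close>)
qed

end
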